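(* There are constants $0<c,C<\infty$ such that for every nonempty finite connected $B\subset\mathcal{H}$, $$H_B\le C\Big(\min_{x\in B}\{x_2\}+|B|\Big),$$ while $$H_B\ge c\,\frac{\max_{x\in B}\{x_2\}}{\log\big(\max_{x\in B}\{x_2\}\big)}\qquad\text{when } \max_{x\in B}\{x_2\}\ge 2,$$ and $$H_B\ge 1\qquad\text{when } \max_{x\in B}\{x_2\}=0.$$
   Context: $\mathcal{H}=\{(x_1,x_2)\in\mathbb{Z}^2: x_2\ge 0\}$; points are written $x=(x_1,x_2)$; $L_n=\{(k,n):k\in\mathbb{Z}\}$ for integers $n\ge 0$. Connectedness is with respect to nearest-neighbor adjacency in $\mathbb{Z}^2$; $|B|$ is the cardinality of $B$. $(S_n)_{n\ge 0}$ is simple random walk on $\mathbb{Z}^2$, $P_z$ is its law when $S_0=z$, and for $A\subset\mathbb{Z}^2$, $\bar\tau_A=\min\{n\ge 0:S_n\in A\}$. For $B\subset\mathcal{H}$, $x\in B$ and an integer $N\geq 1$, $$H_{B,N}(x)=\sum_{z\in L_N\setminus B}P_z\big(S_{\bar\tau_{B\cup L_0}}=x\big),\qquad H_B(x)=\lim_{N\to\infty}H_{B,N}(x)$$ (the limit exists and is finite). For finite $B$, the (total) stationary harmonic measure of $B$ is $H_B=\sum_{x\in B}H_B(x)$. *)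

theory Defs
  imports "HOL-Probability.Probability"
begin

type_synonym point = "int \<times> int"

definition upper_half_plane :: "point set" where
  "upper_half_plane = {x. snd x \<ge> 0}"

definition level :: "nat \<Rightarrow> point set" where
  "level n = {x. snd x = int n}"

definition unit_steps :: "point set" where
  "unit_steps = {(1, 0), (-1, 0), (0, 1), (0, -1)}"

definition lattice_connected :: "point set \<Rightarrow> bool" where
  "lattice_connected B \<longleftrightarrow>
     (\<forall>x\<in>B. \<forall>y\<in>B. (x, y) \<in> {(u, v). u \<in> B \<and> v \<in> B \<and> v - u \<in> unit_steps}\<^sup>*)"

definition path_space :: "(nat \<Rightarrow> point) measure" where
  "path_space = (\<Pi>\<^sub>M n\<in>UNIV. count_space UNIV)"

text \<open>The law on path space of the walk started at \<open>z\<close>: the increments are independent and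
  uniform on the four unit steps.\<close>

definition srw :: "point \<Rightarrow> (nat \<Rightarrow> point) measure" where
  "srw z = distr (\<Pi>\<^sub>M n\<in>UNIV. measure_pmf (pmf_of_set unit_steps)) path_space
     (\<lambda>\<omega> n. z + (\<Sum>i<n. \<omega> i))"

text \<open>The infimum is \<open>\<infinity>\<close> if the path never enters \<open>A\<close>.\<close>

definition hitting_time :: "point set \<Rightarrow> (nat \<Rightarrow> point) \<Rightarrow> enat" where
  "hitting_time A S = Inf (enat ` {n. S n \<in> A})"

definition hits_at :: "point set \<Rightarrow> point \<Rightarrow> (nat \<Rightarrow> point) \<Rightarrow> bool" where
  "hits_at A x S \<longleftrightarrow> (\<exists>n. hitting_time A S = enat n \<and> S n = x)"

text \<open>The following quantities take values in \<^typ>\<open>ennreal\<close>, so that the infinite sum over a level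
  is always meaningful.\<close>

definition harm_from_level :: "point set \<Rightarrow> nat \<Rightarrow> point \<Rightarrow> ennreal" where
  "harm_from_level B N x =
     (\<Sum>\<^sub>\<infinity>z\<in>level N - B. emeasure (srw z) {S \<in> space (srw z). hits_at (B \<union> level 0) x S})"

definition stationary_harm :: "point set \<Rightarrow> point \<Rightarrow> ennreal" where
  "stationary_harm B x = lim (\<lambda>N. harm_from_level B N x)"

definition total_stationary_harm :: "point set \<Rightarrow> ennreal" where
  "total_stationary_harm B = (\<Sum>x\<in>B. stationary_harm B x)"

text \<open>Well-definedness: \<^term>\<open>srw z\<close> is a probability measure and the hitting events are measurable.\<close>

lemma path_measurable:
  "(\<lambda>\<omega> n. z + (\<Sum>i<n. \<omega> i)) \<in>
     measurable (\<Pi>\<^sub>M n\<in>UNIV. measure_pmf (pmf_of_set unit_steps)) path_space"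
proof -
  have cnt: "(\<lambda>\<omega>. z + (\<Sum>i<n. \<omega> i)) \<in>
     measurable (\<Pi>\<^sub>M n\<in>UNIV. measure_pmf (pmf_of_set unit_steps)) (count_space UNIV)" for n :: nat
  proof (induction n)
    case 0
    show ?case by simp
  next
    case (Suc n)
    have 1: "(\<lambda>\<omega>. \<omega> n) \<in> measurable (\<Pi>\<^sub>M n\<in>(UNIV :: nat set).
        measure_pmf (pmf_of_set unit_steps)) (count_space UNIV)"
      using measurable_component_singleton[of n UNIV "\<lambda>_. measure_pmf (pmf_of_set unit_steps)"]
      by simp
    have "(\<lambda>\<omega>. (z + (\<Sum>i<n. \<omega> i)) + \<omega> n) \<in>
     measurable (\<Pi>\<^sub>M n\<in>UNIV. measure_pmf (pmf_of_set unit_steps)) (count_space UNIV)"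
      by (rule measurable_compose_countable[OF _ Suc.IH, where f = "\<lambda>a \<omega>. a + \<omega> n"])
        (rule measurable_compose[OF 1], simp)
    then show ?case by (simp add: add.assoc)
  qed
  show ?thesis
    unfolding path_space_def by (intro measurable_PiM_single') (use cnt in auto)
qed

lemma prob_space_srw: "prob_space (srw z)"
proof -
  interpret product_prob_space "\<lambda>_. measure_pmf (pmf_of_set unit_steps)" "UNIV :: nat set"
    by unfold_locales
  show ?thesis
    unfolding srw_def by (intro P.prob_space_distr path_measurable)
qed

lemma sets_srw [measurable_cong]: "sets (srw z) = sets path_space"
  by (simp add: srw_def)

lemma hits_at_iff:
  "hits_at A x S \<longleftrightarrow> (\<exists>n. S n \<in> A \<and> S n = x \<and> (\<forall>m<n. S m \<notin> A))"
proof
  assume "hits_at A x S"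
  then obtain n where n: "Inf (enat ` {n. S n \<in> A}) = enat n" "S n = x"
    by (auto simp: hits_at_def hitting_time_def)
  then have ne: "enat ` {n. S n \<in> A} \<noteq> {}" by (auto simp: Inf_enat_def split: if_splits)
  then obtain k where "k \<in> enat ` {n. S n \<in> A}" by blast
  then have "(LEAST k. k \<in> enat ` {n. S n \<in> A}) \<in> enat ` {n. S n \<in> A}" by (rule LeastI)
  with ne have "Inf (enat ` {n. S n \<in> A}) \<in> enat ` {n. S n \<in> A}"
    unfolding Inf_enat_def by (simp only: if_False)
  then have "S n \<in> A" using n by auto
  moreover have "S m \<notin> A" if "m < n" for m
  proof
    assume "S m \<in> A"
    then have "Inf (enat ` {n. S n \<in> A}) \<le> enat m" by (intro Inf_lower) auto
    with n that show False by simp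
  qed
  ultimately show "\<exists>n. S n \<in> A \<and> S n = x \<and> (\<forall>m<n. S m \<notin> A)" using n by blast
next
  assume "\<exists>n. S n \<in> A \<and> S n = x \<and> (\<forall>m<n. S m \<notin> A)"
  then obtain n where n: "S n \<in> A" "S n = x" "\<forall>m<n. S m \<notin> A" by blast
  have "Inf (enat ` {n. S n \<in> A}) = enat n"
    using n by (intro antisym Inf_lower Inf_greatest) (auto simp: not_less[symmetric])
  then show "hits_at A x S" using n by (auto simp: hits_at_def hitting_time_def)
qed

lemma hits_at_measurable: "{S \<in> space (srw z). hits_at A x S} \<in> sets (srw z)"
proof -
  have [measurable]: "(\<lambda>S. S n) \<in> measurable (srw z) (count_space UNIV)" for n
    unfolding srw_def path_space_def measurable_distr_eq1
    by (rule measurable_component_singleton) simp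
  have [measurable]: "Measurable.pred (srw z) (\<lambda>S. P (S n))" for n and P :: "point \<Rightarrow> bool"
    by (rule measurable_compose[where N = "count_space UNIV"]) simp_all
  show ?thesis unfolding hits_at_iff by measurable
qed

end

theory Submission
  imports Defs
begin

text \<open>For \<open>x \<in> B\<close> the function \<open>z \<mapsto> P\<^sub>z(S hits B \<union> L\<^sub>0 first at x)\<close> is harmonic off \<open>B \<union> L\<^sub>0\<close>. Hence its row
  sums are affine in the height above \<open>B\<close>; being bounded, they are constant there, so the limit exists
  and the total harmonic measure is a single row sum of \<open>u(z) = P\<^sub>z(S hits B \<union> L\<^sub>0 first in B)\<close>.

  Upper bound: with \<open>R = min x\<^sub>2 + |B|\<close>, connectedness puts \<open>B\<close> into a box of size \<open>R\<close>, from which the walk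
  hits \<open>L\<^sub>0\<close> in a segment of length \<open>8R + 1\<close> with probability at least \<open>1/2\<close> (compare with a quadratic
  harmonic polynomial). By minimality \<open>u\<close> is at most twice this hitting probability, whose row sums are
  at most the length of the segment, by translation invariance.

  Lower bound: for a highest point \<open>b\<close> of \<open>B\<close>, at height \<open>M\<close>, the function
  \<open>-ln (|z - b|\<^sup>2 - 1/2) + ln (M\<^sup>2 - 1/2)\<close>, suitably truncated at \<open>b\<close>, is subharmonic off \<open>b\<close>, nonpositive
  outside the ball of radius \<open>M\<close> and at most a multiple of \<open>ln M\<close>. By the maximum principle on that ball
  it is bounded by a multiple of \<open>u ln M\<close>, and its sum over the row \<open>M + 1\<close> near \<open>b\<close> is of order \<open>M\<close>.\<close>

subsection \<open>Hitting probabilities\<close>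

definition hit_prob :: "point set \<Rightarrow> point \<Rightarrow> point \<Rightarrow> real" where
  "hit_prob A x z = measure (srw z) {S \<in> space (srw z). hits_at A x S}"

text \<open>\<open>hits_at\<close> with a finite horizon, in the explicit form of
  \<open>hits_at_iff\<close>. The horizon makes first-step recursion and induction on time
  available.\<close>

definition hits_by :: "point set \<Rightarrow> point \<Rightarrow> nat \<Rightarrow> (nat \<Rightarrow> point) \<Rightarrow> bool" where
  "hits_by A x n S \<longleftrightarrow> (\<exists>m\<le>n. S m \<in> A \<and> S m = x \<and> (\<forall>j<m. S j \<notin> A))"

definition hit_prob_upto :: "point set \<Rightarrow> point \<Rightarrow> nat \<Rightarrow> point \<Rightarrow> real" where
  "hit_prob_upto A x n z = measure (srw z) {S \<in> space (srw z). hits_by A x n S}"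

definition nbr_avg :: "(point \<Rightarrow> real) \<Rightarrow> point \<Rightarrow> real" where
  "nbr_avg f z = (f (z + (1, 0)) + f (z + (-1, 0)) + f (z + (0, 1)) + f (z + (0, -1))) / 4"

lemma nbr_avg_mono: "(\<And>z. f z \<le> g z) \<Longrightarrow> nbr_avg f z \<le> nbr_avg g z"
  unfolding nbr_avg_def by (intro divide_right_mono add_mono) auto

lemma nbr_avg_sum: "nbr_avg (\<lambda>z. \<Sum>x\<in>X. f x z) z = (\<Sum>x\<in>X. nbr_avg (f x) z)"
  by (simp add: nbr_avg_def sum.distrib flip: sum_divide_distrib)

lemma hits_by_measurable:
  "{S \<in> space (srw z). hits_by A x n S} \<in> sets (srw z)"
proof -
  have [measurable]: "(\<lambda>S. S n) \<in> measurable (srw z) (count_space UNIV)" for n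
    unfolding srw_def path_space_def measurable_distr_eq1
    by (rule measurable_component_singleton) simp
  have [measurable]: "Measurable.pred (srw z) (\<lambda>S. P (S n))" for n and P :: "point \<Rightarrow> bool"
    by (rule measurable_compose[where N = "count_space UNIV"]) simp_all
  show ?thesis unfolding hits_by_def by measurable
qed

section \<open>The walk as a function of its independent steps\<close>

abbreviation step_law :: "point measure" where
  "step_law \<equiv> measure_pmf (pmf_of_set unit_steps)"

abbreviation steps_law :: "(nat \<Rightarrow> point) measure" where
  "steps_law \<equiv> \<Pi>\<^sub>M n\<in>UNIV. step_law"

definition walk :: "point \<Rightarrow> (nat \<Rightarrow> point) \<Rightarrow> nat \<Rightarrow> point" where
  "walk z \<omega> n = z + (\<Sum>i<n. \<omega> i)"

lemma walk_measurable: "walk z \<in> measurable steps_law path_space"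
  using path_measurable[of z] unfolding walk_def[abs_def] .

lemma srw_walk: "srw z = distr steps_law path_space (walk z)"
  by (simp add: srw_def walk_def[abs_def])

lemma walk_simps:
  "walk z \<omega> 0 = z"
  "walk z (case_nat s \<omega>) (Suc n) = walk (z + s) \<omega> n"
  by (simp_all add: walk_def sum.lessThan_Suc_shift add.assoc del: sum.lessThan_Suc)

lemma hits_by_0: "hits_by A x 0 S \<longleftrightarrow> S 0 = x \<and> x \<in> A"
  by (auto simp: hits_by_def)

lemma hits_by_hit: "S 0 \<in> A \<Longrightarrow> hits_by A x n S \<longleftrightarrow> S 0 = x"
  unfolding hits_by_def by (metis le0 not_gr_zero not_less0)

text \<open>Markov property at time 1, path by path: from a start outside \<open>A\<close> any hit
  happens at a positive time, so removing the first step shifts every time by one.\<close>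

lemma hits_by_walk_Suc:
  assumes "z \<notin> A"
  shows "hits_by A x (Suc n) (walk z (case_nat s \<omega>)) \<longleftrightarrow> hits_by A x n (walk (z + s) \<omega>)"
proof -
  have *: "(\<exists>m\<le>Suc n. P m) \<longleftrightarrow> P 0 \<or> (\<exists>m\<le>n. P (Suc m))" for P
    by (metis Suc_le_mono le0 not0_implies_Suc)
  have **: "(\<forall>j<Suc m. P j) \<longleftrightarrow> P 0 \<and> (\<forall>j<m. P (Suc j))" for P m
    by (auto simp: less_Suc_eq_0_disj)
  show ?thesis
    using assms unfolding hits_by_def * ** walk_simps by simp
qed

lemma measure_srw:
  assumes "{S \<in> space (srw z). P S} \<in> sets (srw z)"
  shows "{\<omega> \<in> space steps_law. P (walk z \<omega>)} \<in> sets steps_law"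
    and "emeasure (srw z) {S \<in> space (srw z). P S} =
      emeasure steps_law {\<omega> \<in> space steps_law. P (walk z \<omega>)}"
proof -
  have sp: "space path_space = UNIV"
    by (simp add: path_space_def space_PiM PiE_UNIV_domain)
  have eq: "walk z -` {S \<in> space (srw z). P S} \<inter> space steps_law =
      {\<omega> \<in> space steps_law. P (walk z \<omega>)}"
    by (auto simp: srw_walk sp)
  have m: "{S \<in> space (srw z). P S} \<in> sets path_space"
    using assms by (simp add: srw_walk)
  show "{\<omega> \<in> space steps_law. P (walk z \<omega>)} \<in> sets steps_law"
    using measurable_sets[OF walk_measurable[of z] m] by (simp only: eq)
  show "emeasure (srw z) {S \<in> space (srw z). P S} =
      emeasure steps_law {\<omega> \<in> space steps_law. P (walk z \<omega>)}"
    using emeasure_distr[OF walk_measurable m] eq by (simp add: srw_walk)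
qed

lemma hit_prob_upto_steps:
  "ennreal (hit_prob_upto A x n z) =
     emeasure steps_law {\<omega> \<in> space steps_law. hits_by A x n (walk z \<omega>)}"
proof -
  interpret srw: prob_space "srw z" by (rule prob_space_srw)
  show ?thesis
    unfolding hit_prob_upto_def srw.emeasure_eq_measure[symmetric]
    by (rule measure_srw(2)[OF hits_by_measurable])
qed

lemma hit_prob_upto_nonneg: "hit_prob_upto A x n z \<ge> 0"
  by (simp add: hit_prob_upto_def)

lemma hit_prob_nonneg: "hit_prob A x z \<ge> 0"
  by (simp add: hit_prob_def)

lemma measure_prop_const:
  "prob_space M \<Longrightarrow> measure M {S \<in> space M. c} = of_bool c"
  by (cases c) (simp_all add: prob_space.prob_space)

text \<open>Only almost sure, because \<open>srw z\<close> is a measure on all sequences of points,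
  including those that start elsewhere.\<close>

lemma walk_start: "AE S in srw z. S 0 = z"
proof -
  have "AE \<omega> in steps_law. walk z \<omega> 0 = z" by (simp add: walk_simps)
  moreover have "{S \<in> space path_space. S 0 = z} \<in> sets path_space"
  proof -
    have "(\<lambda>S. S 0) \<in> measurable path_space (count_space UNIV)"
      unfolding path_space_def by (rule measurable_component_singleton) simp
    from measurable_sets[OF this, of "{z}"] show ?thesis
      by (simp add: vimage_def Int_def conj_commute)
  qed
  ultimately show ?thesis
    unfolding srw_walk by (subst AE_distr_iff[OF walk_measurable])
qed

lemma hit_prob_upto_0: "hit_prob_upto A x 0 z = of_bool (z = x \<and> x \<in> A)"
proof -
  interpret srw: prob_space "srw z" by (rule prob_space_srw)
  have "hit_prob_upto A x 0 z = measure (srw z) {S \<in> space (srw z). z = x \<and> x \<in> A}"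
    unfolding hit_prob_upto_def hits_by_0
  proof (rule srw.finite_measure_eq_AE)
    show "AE S in srw z. (S \<in> {S \<in> space (srw z). S 0 = x \<and> x \<in> A}) =
        (S \<in> {S \<in> space (srw z). z = x \<and> x \<in> A})"
      using walk_start by eventually_elim auto
    show "{S \<in> space (srw z). S 0 = x \<and> x \<in> A} \<in> sets (srw z)"
      using hits_by_measurable[of z A x 0] by (simp add: hits_by_0)
  qed auto
  then show ?thesis by (simp only: measure_prop_const[OF prob_space_srw])
qed

lemma hit_prob_upto_hit:
  assumes "z \<in> A"
  shows "hit_prob_upto A x n z = of_bool (z = x)"
proof -
  interpret srw: prob_space "srw z" by (rule prob_space_srw)
  have "hit_prob_upto A x n z = measure (srw z) {S \<in> space (srw z). z = x}"
    unfolding hit_prob_upto_def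
  proof (rule srw.finite_measure_eq_AE)
    show "AE S in srw z. (S \<in> {S \<in> space (srw z). hits_by A x n S}) =
        (S \<in> {S \<in> space (srw z). z = x})"
      using walk_start by eventually_elim (use assms in \<open>auto simp: hits_by_hit\<close>)
  qed (auto intro: hits_by_measurable)
  then show ?thesis by (simp only: measure_prop_const[OF prob_space_srw])
qed

lemma unit_steps_pmf: "finite unit_steps" "unit_steps \<noteq> {}" "card unit_steps = 4"
  by (simp_all add: unit_steps_def)

text \<open>First-step analysis: an i.i.d. sequence has the law of an independent step put in front
  of such a sequence (\<open>PiM_iter\<close>), and Fubini averages the shifted event over the four
  steps.\<close>

lemma hit_prob_upto_Suc:
  assumes "z \<notin> A"
  shows "hit_prob_upto A x (Suc n) z = nbr_avg (hit_prob_upto A x n) z"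
proof -
  interpret sequence_space step_law ..
  let ?E = "{\<omega> \<in> space steps_law. hits_by A x (Suc n) (walk z \<omega>)}"
  have E: "?E \<in> sets steps_law" by (rule measure_srw(1)[OF hits_by_measurable])
  have m: "(\<lambda>(s, \<omega>). case_nat s \<omega>) \<in> measurable (step_law \<Otimes>\<^sub>M steps_law) steps_law"
    by (simp add: split_beta')
  have "emeasure steps_law ?E =
      emeasure (distr (step_law \<Otimes>\<^sub>M steps_law) steps_law (\<lambda>(s, \<omega>). case_nat s \<omega>)) ?E"
    by (simp only: PiM_iter)
  also have "\<dots> = emeasure (step_law \<Otimes>\<^sub>M steps_law)
      ((\<lambda>(s, \<omega>). case_nat s \<omega>) -` ?E \<inter> space (step_law \<Otimes>\<^sub>M steps_law))"
    by (rule emeasure_distr[OF m E])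
  also have "\<dots> = (\<integral>\<^sup>+ s. emeasure steps_law (Pair s -` ((\<lambda>(s, \<omega>). case_nat s \<omega>) -` ?E \<inter> space (step_law \<Otimes>\<^sub>M steps_law))) \<partial>step_law)"
    by (rule P.emeasure_pair_measure_alt[OF measurable_sets[OF m E]])
  also have "\<dots> = (\<integral>\<^sup>+ s. ennreal (hit_prob_upto A x n (z + s)) \<partial>step_law)"
    unfolding hit_prob_upto_steps
    by (intro nn_integral_cong arg_cong2[where f = emeasure])
      (auto simp: space_pair_measure space_PiM PiE_UNIV_domain hits_by_walk_Suc[OF assms])
  also have "\<dots> = (\<Sum>s\<in>unit_steps. ennreal (hit_prob_upto A x n (z + s))) / 4"
    by (simp add: nn_integral_pmf_of_set unit_steps_pmf)
  also have "\<dots> = ennreal (nbr_avg (hit_prob_upto A x n) z)"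
    by (simp add: unit_steps_def nbr_avg_def hit_prob_upto_nonneg add.assoc divide_ennreal
        flip: ennreal_plus ennreal_numeral)
  finally have "ennreal (hit_prob_upto A x (Suc n) z) = ennreal (nbr_avg (hit_prob_upto A x n) z)"
    by (simp only: hit_prob_upto_steps)
  then show ?thesis
    by (subst (asm) ennreal_inj) (auto simp: hit_prob_upto_nonneg nbr_avg_def)
qed

lemma hit_prob_upto_LIMSEQ: "(\<lambda>n. hit_prob_upto A x n z) \<longlonglongrightarrow> hit_prob A x z"
proof -
  interpret srw: prob_space "srw z" by (rule prob_space_srw)
  have "(\<lambda>n. measure (srw z) {S \<in> space (srw z). hits_by A x n S}) \<longlonglongrightarrow>
      measure (srw z) (\<Union>n. {S \<in> space (srw z). hits_by A x n S})"
  proof (rule srw.finite_Lim_measure_incseq)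
    show "incseq (\<lambda>n. {S \<in> space (srw z). hits_by A x n S})"
      unfolding incseq_def hits_by_def by (blast intro: order_trans)
  qed (auto intro: hits_by_measurable)
  moreover have "(\<Union>n. {S \<in> space (srw z). hits_by A x n S}) =
      {S \<in> space (srw z). hits_at A x S}"
    by (auto simp: hits_at_iff hits_by_def)
  ultimately show ?thesis by (simp add: hit_prob_upto_def hit_prob_def)
qed

section \<open>Boundary values, harmonicity, minimality and translation invariance\<close>

lemma hit_prob_hit:
  assumes "z \<in> A"
  shows "hit_prob A x z = of_bool (z = x)"
  using hit_prob_upto_LIMSEQ[of A x z] assms by (simp add: hit_prob_upto_hit LIMSEQ_const_iff)

lemma hit_prob_harmonic:
  assumes "z \<notin> A"
  shows "nbr_avg (hit_prob A x) z = hit_prob A x z"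
proof -
  have "(\<lambda>n. hit_prob_upto A x (Suc n) z) \<longlonglongrightarrow> nbr_avg (hit_prob A x) z"
    unfolding hit_prob_upto_Suc[OF assms] nbr_avg_def
    by (intro tendsto_intros hit_prob_upto_LIMSEQ) simp
  then show ?thesis
    using LIMSEQ_unique LIMSEQ_Suc[OF hit_prob_upto_LIMSEQ] by blast
qed

text \<open>Induction on the horizon: off \<open>A\<close> the truncated probabilities obey the
  averaging recursion exactly, while averaging does not increase \<open>g\<close>. This covers
  infinite complements of \<open>A\<close>, which the maximum principle on finite sets does not
  reach.\<close>

lemma sum_hit_prob_minimal:
  assumes "finite X" "\<And>z. g z \<ge> 0" "\<And>x. x \<in> X \<inter> A \<Longrightarrow> g x \<ge> 1"
    "\<And>z. z \<notin> A \<Longrightarrow> nbr_avg g z \<le> g z"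
  shows "(\<Sum>x\<in>X. hit_prob A x z) \<le> g z"
proof -
  \<comment> \<open>One inequality serves both horizon \<open>0\<close> and, at any later horizon,
    every start in \<open>A\<close>.\<close>
  have A: "(\<Sum>x\<in>X. of_bool (z = x \<and> x \<in> A)) \<le> g z" for z
  proof -
    have "(\<Sum>x\<in>X. of_bool (z = x \<and> x \<in> A)) = (\<Sum>x\<in>X. if z = x then of_bool (x \<in> A) else 0 :: real)"
      by (intro sum.cong) auto
    also have "\<dots> = (if z \<in> X then of_bool (z \<in> A) else 0)"
      using assms(1) by (simp add: sum.delta)
    also have "\<dots> \<le> g z" using assms(2)[of z] assms(3)[of z] by auto
    finally show ?thesis .
  qed
  have "(\<Sum>x\<in>X. hit_prob_upto A x n z) \<le> g z" for n z
  proof (induction n arbitrary: z)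
    case 0
    show ?case using A[of z] by (simp only: hit_prob_upto_0)
  next
    case (Suc n)
    show ?case
    proof (cases "z \<in> A")
      case True
      then show ?thesis using A[of z]
        by (subst sum.cong[OF refl, of _ _ "\<lambda>x. of_bool (z = x \<and> x \<in> A)"])
          (auto simp: hit_prob_upto_hit)
    next
      case False
      have "(\<Sum>x\<in>X. hit_prob_upto A x (Suc n) z) = nbr_avg (\<lambda>z. \<Sum>x\<in>X. hit_prob_upto A x n z) z"
        by (simp add: hit_prob_upto_Suc[OF False] nbr_avg_sum)
      also have "\<dots> \<le> nbr_avg g z" by (rule nbr_avg_mono) (rule Suc.IH)
      also have "\<dots> \<le> g z" by (rule assms(4)[OF False])
      finally show ?thesis .
    qed
  qed
  then show ?thesis
    by (intro LIMSEQ_le_const2[OF tendsto_sum[OF hit_prob_upto_LIMSEQ]]) auto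
qed

lemma sum_hit_prob_le_1: "finite X \<Longrightarrow> (\<Sum>x\<in>X. hit_prob A x z) \<le> 1"
  by (rule sum_hit_prob_minimal) (simp_all add: nbr_avg_def)

text \<open>Both sides obey the same recursion in the horizon with the same initial values, so they
  agree at every horizon and hence in the limit.\<close>

lemma hit_prob_translate:
  "hit_prob A x (z + v) = hit_prob {w. w + v \<in> A} (x - v) z"
proof -
  have sw: "nbr_avg f (z + v) = nbr_avg (\<lambda>z. f (z + v)) z" for f z
    by (simp add: nbr_avg_def algebra_simps)
  have "hit_prob_upto A x n (z + v) = hit_prob_upto {w. w + v \<in> A} (x - v) n z" for n
  proof (induction n arbitrary: z)
    case 0
    then show ?case by (auto simp: hit_prob_upto_0 eq_diff_eq)
  next
    case (Suc n)
    show ?case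
      by (cases "z + v \<in> A")
        (simp_all add: hit_prob_upto_hit eq_diff_eq hit_prob_upto_Suc sw Suc.IH)
  qed
  then show ?thesis
    using LIMSEQ_unique[OF hit_prob_upto_LIMSEQ[of A x "z + v"]]
      hit_prob_upto_LIMSEQ[of "{w. w + v \<in> A}" "x - v" z] by simp
qed

subsection \<open>Comparison on finite boxes\<close>

text \<open>Among the points where a positive maximum is attained take a rightmost one. Averaging
  forces its right neighbour to attain the maximum too; being positive there, \<open>d\<close> keeps
  that neighbour in \<open>D\<close>, against the choice.\<close>

lemma nbr_avg_max_principle:
  assumes "finite D"
    and sub: "\<And>z. z \<in> D \<Longrightarrow> d z \<le> nbr_avg d z"
    and out: "\<And>z. z \<notin> D \<Longrightarrow> d z \<le> 0"
  shows "d z \<le> 0"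
proof (rule ccontr)
  assume "\<not> d z \<le> 0"
  then have zD: "z \<in> D" and pos: "d z > 0" using out[of z] by auto
  define m where "m = Max (d ` D)"
  have le: "d w \<le> m" if "w \<in> D" for w using that assms(1) by (simp add: m_def)
  have mpos: "m > 0" using le[OF zD] pos by simp
  have le': "d w \<le> m" for w
    using le[of w] out[of w] mpos by (cases "w \<in> D") auto
  define X where "X = {w \<in> D. d w = m}"
  have finX: "finite X" using assms(1) by (simp add: X_def)
  have "m \<in> d ` D" unfolding m_def using assms(1) zD by (intro Max_in) auto
  then have "X \<noteq> {}" by (auto simp: X_def)
  then have "Max (fst ` X) \<in> fst ` X" using finX by (intro Max_in) auto
  then obtain w where w: "w \<in> X" "fst w = Max (fst ` X)" by auto
  then have "m \<le> nbr_avg d w" using sub[of w] by (auto simp: X_def)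
  then have "d (w + (1, 0)) \<ge> m"
    using le'[of "w + (1, 0)"] le'[of "w + (-1, 0)"] le'[of "w + (0, 1)"] le'[of "w + (0, -1)"]
    unfolding nbr_avg_def by simp
  then have "d (w + (1, 0)) = m" using le' by (simp add: antisym)
  then have "w + (1, 0) \<in> X" using out[of "w + (1, 0)"] mpos by (force simp: X_def)
  then have "fst (w + (1, 0)) \<le> Max (fst ` X)"
    using finX by (intro Max_ge finite_imageI imageI)
  then show False using w by simp
qed

text \<open>Discrete intermediate value property: a unit step changes either coordinate by at most
  one, so a path in \<open>B\<close> skips no value between its end values.\<close>

lemma connected_interval:
  assumes "lattice_connected B" "x \<in> B" "y \<in> B" "p = fst \<or> p = snd"
  shows "{min (p x) (p y)..max (p x) (p y)} \<subseteq> p ` B"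
proof -
  have "(x, y) \<in> {(u, v). u \<in> B \<and> v \<in> B \<and> v - u \<in> unit_steps}\<^sup>*"
    using assms by (auto simp: lattice_connected_def)
  then show ?thesis
  proof (induction rule: rtrancl_induct)
    case base
    show ?case using assms(2) by auto
  next
    case (step v w)
    have "p w - p v = p (w - v)" using assms(4) by auto
    moreover have "\<bar>p (w - v)\<bar> \<le> 1" using step.hyps assms(4) by (auto simp: unit_steps_def)
    ultimately have "\<bar>p w - p v\<bar> \<le> 1" by simp
    then have "{min (p x) (p w)..max (p x) (p w)} \<subseteq>
        insert (p w) {min (p x) (p v)..max (p x) (p v)}"
      by auto
    moreover have "p w \<in> p ` B" using step.hyps by auto
    ultimately show ?case using step.IH by blast
  qed
qed

text \<open>All values between the two coordinates are taken on \<open>B\<close>, and there is one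
  more of them than the difference, which makes the inequality strict.\<close>

lemma connected_diff_le_card:
  assumes "finite B" "lattice_connected B" "x \<in> B" "y \<in> B" "p = fst \<or> p = snd"
  shows "\<bar>p x - p y\<bar> < int (card B)"
proof -
  have "card {min (p x) (p y)..max (p x) (p y)} \<le> card (p ` B)"
    using connected_interval[OF assms(2-5)] assms(1) by (intro card_mono) auto
  also have "\<dots> \<le> card B" using assms(1) by (rule card_image_le)
  finally show ?thesis by (auto split: split_min split_max)
qed

section \<open>Hitting segments of the ground level\<close>

definition ground_segment :: "int \<Rightarrow> int \<Rightarrow> point set" where
  "ground_segment k T = (\<lambda>j. (j, 0)) ` {k - T..k + T}"

lemma finite_ground_segment [simp]: "finite (ground_segment k T)"
  by (simp add: ground_segment_def)

lemma sum_ground_segment: "(\<Sum>y\<in>ground_segment k T. f y) = (\<Sum>j\<in>{k - T..k + T}. f (j, 0))"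
  unfolding ground_segment_def by (subst sum.reindex) (auto simp: inj_on_def)

lemma sum_hit_prob_hit:
  assumes "finite X" "z \<in> A"
  shows "(\<Sum>x\<in>X. hit_prob A x z) = of_bool (z \<in> X)"
  using assms by (simp add: hit_prob_hit of_bool_def)

lemma sum_hit_prob_harmonic:
  assumes "z \<notin> A"
  shows "nbr_avg (\<lambda>z. \<Sum>x\<in>X. hit_prob A x z) z = (\<Sum>x\<in>X. hit_prob A x z)"
  by (simp add: nbr_avg_sum hit_prob_harmonic[OF assms])

text \<open>The harmonic polynomial \<open>((T - n)\<^sup>2 - k\<^sup>2) / T\<^sup>2\<close> is at most \<open>1\<close> on the bottom and nonpositive on
  the other sides of the box \<open>\<bar>k\<bar> \<le> T\<close>, \<open>0 \<le> n \<le> T\<close>.\<close>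

lemma ground_segment_hit_prob_ge:
  assumes T: "T > 0" and kn: "\<bar>k - a\<bar> \<le> T" "0 \<le> n" "n \<le> T"
  shows "(\<Sum>y\<in>ground_segment a T. hit_prob (level 0) y (k, n)) \<ge>
    (real_of_int (T - n) ^ 2 - real_of_int (k - a) ^ 2) / real_of_int T ^ 2"
proof -
  define w where "w = (\<lambda>z. \<Sum>y\<in>ground_segment a T. hit_prob (level 0) y z)"
  define s where "s = (\<lambda>z :: point. (real_of_int (T - snd z) ^ 2 - real_of_int (fst z - a) ^ 2) / real_of_int T ^ 2)"
  define Box where "Box = {z :: point. \<bar>fst z - a\<bar> \<le> T \<and> 0 \<le> snd z \<and> snd z \<le> T}"
  \<comment> \<open>The interior of \<open>Box\<close>: neighbours of its points stay in
    \<open>Box\<close>, so the cut-off in \<open>d\<close> does not affect averages there. The value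
    zero outside \<open>Box\<close> meets the exterior condition of the maximum principle.\<close>
  define D where "D = {a - T<..<a + T} \<times> {0<..<T}"
  define d where "d = (\<lambda>z. if z \<in> Box then s z - w z else 0)"
  have wn: "w z \<ge> 0" for z by (simp add: w_def sum_nonneg hit_prob_nonneg)
  have "d (k, n) \<le> 0"
  proof (rule nbr_avg_max_principle)
    show "finite D" by (simp add: D_def)
  next
    fix z assume z: "z \<in> D"
    then have box: "z + (1, 0) \<in> Box" "z + (-1, 0) \<in> Box" "z + (0, 1) \<in> Box"
      "z + (0, -1) \<in> Box" "z \<in> Box"
      by (auto simp: D_def Box_def)
    have "z \<notin> level 0" using z by (auto simp: D_def level_def)
    then have w: "nbr_avg w z = w z" unfolding w_def by (rule sum_hit_prob_harmonic)
    have s: "nbr_avg s z = s z"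
    proof -
      have "nbr_avg (\<lambda>z. real_of_int (T - snd z) ^ 2 - real_of_int (fst z - a) ^ 2) z =
          real_of_int (T - snd z) ^ 2 - real_of_int (fst z - a) ^ 2"
        by (simp add: nbr_avg_def power2_eq_square field_simps)
      moreover have "nbr_avg (\<lambda>z. f z / c) z = nbr_avg f z / c" for f c
        by (simp add: nbr_avg_def add_divide_distrib)
      ultimately show ?thesis by (simp add: s_def)
    qed
    have "nbr_avg d z = nbr_avg s z - nbr_avg w z"
      by (simp add: nbr_avg_def d_def box field_simps)
    then show "d z \<le> nbr_avg d z" by (simp add: w s d_def box)
  next
    fix z :: point assume z: "z \<notin> D"
    show "d z \<le> 0"
    proof (cases "z \<in> Box")
      case True
      have "s z \<le> w z"
      proof (cases "snd z = 0")
        case True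
        then have "w z = of_bool (z \<in> ground_segment a T)"
          unfolding w_def by (intro sum_hit_prob_hit) (auto simp: level_def)
        moreover have "z \<in> ground_segment a T"
          using True \<open>z \<in> Box\<close> by (cases z) (simp add: ground_segment_def Box_def image_iff abs_le_iff; linarith)
        moreover have "s z \<le> 1" using True T by (simp add: s_def field_simps)
        ultimately show ?thesis by simp
      next
        case False
        with z \<open>z \<in> Box\<close> have "\<bar>fst z - a\<bar> = T \<and> 0 \<le> snd z \<and> snd z \<le> T \<or> snd z = T"
          by (cases z) (auto simp: D_def Box_def)
        then have "\<bar>T - snd z\<bar> \<le> \<bar>fst z - a\<bar>" by auto
        then have "\<bar>real_of_int (T - snd z)\<bar> \<le> \<bar>real_of_int (fst z - a)\<bar>" by linarith
        then have "s z \<le> 0" by (simp add: s_def abs_le_square_iff divide_nonpos_nonneg)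
        with wn[of z] show ?thesis by simp
      qed
      then show ?thesis by (simp add: d_def)
    qed (simp add: d_def)
  qed
  then show ?thesis using kn by (simp add: d_def Box_def s_def w_def)
qed

lemma hit_prob_ground_translate:
  "hit_prob (level 0) (j, 0) (k, n) = hit_prob (level 0) (j - k, 0) (0, n)"
  using hit_prob_translate[of "level 0" "(j, 0)" "(0, n)" "(k, 0)"]
  by (simp add: level_def cong: conj_cong)

text \<open>Translation invariance trades a sum over starting points with one target for a sum over
  targets with one starting point, that is, for a single hitting probability.\<close>

lemma sum_row_hit_prob_ground:
  "(\<Sum>k\<in>F. hit_prob (level 0) (j, 0) (k, n)) =
     (\<Sum>y\<in>(\<lambda>k. (j - k, 0)) ` F. hit_prob (level 0) y (0, n))"
  by (subst sum.reindex) (auto simp: inj_on_def hit_prob_ground_translate[of j])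

lemma sum_row_hit_prob_ground_le_1:
  "finite F \<Longrightarrow> (\<Sum>k\<in>F. hit_prob (level 0) (j, 0) (k, n)) \<le> 1"
  unfolding sum_row_hit_prob_ground by (intro sum_hit_prob_le_1) simp

text \<open>The polynomial bound on the central axis of the box. For fixed \<open>n\<close> it tends
  to \<open>1\<close> as \<open>T\<close> grows.\<close>

lemma sum_row_hit_prob_ground_ge:
  assumes "T > 0" "0 \<le> n" "n \<le> T"
  shows "(\<Sum>k\<in>{j - T..j + T}. hit_prob (level 0) (j, 0) (k, n)) \<ge>
    (real_of_int (T - n) / real_of_int T) ^ 2"
proof -
  have "(-) j ` {j - T..j + T} = {- T..T}"
    by simp
  then have "(\<lambda>k. (j - k, 0)) ` {j - T..j + T} = ground_segment 0 T"
    unfolding ground_segment_def by (simp add: image_image flip: image_image[of "\<lambda>j. (j, 0)" "(-) j"])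
  then show ?thesis
    using ground_segment_hit_prob_ge[of T 0 0 n] assms
    by (simp add: sum_row_hit_prob_ground power_divide)
qed

text \<open>Uniformity in \<open>F\<close> and \<open>n\<close> matters: the bound gives summability
  of each row, boundedness of the row sums in the height, and the final upper bound.\<close>

lemma sum_row_hit_prob_le:
  assumes B: "finite B" "lattice_connected B" "B \<subseteq> upper_half_plane" "B \<noteq> {}" and F: "finite F"
  shows "(\<Sum>k\<in>F. \<Sum>x\<in>B. hit_prob (B \<union> level 0) x (k, n)) \<le>
    18 * (real_of_int (Min (snd ` B)) + real (card B))"
proof -
  define R where "R = Min (snd ` B) + int (card B)"
  have "Min (snd ` B) \<in> snd ` B" using B by (intro Min_in) auto
  then obtain b where b: "b \<in> B" "snd b = Min (snd ` B)" by auto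
  have card: "int (card B) \<ge> 1" using B by (simp add: card_gt_0_iff Suc_le_eq)
  have b0: "snd b \<ge> 0" using B b by (auto simp: upper_half_plane_def)
  have R: "R \<ge> 1" using card b0 b by (simp add: R_def)
  \<comment> \<open>With \<open>T = 4 * R\<close> the polynomial is at least
    \<open>((3 * R)^2 - R^2) / (4 * R)^2 = 1 / 2\<close> on \<open>B\<close>; the factor
    \<open>2\<close> lifts this to \<open>1\<close>.\<close>
  define g where "g = (\<lambda>z. 2 * (\<Sum>y\<in>ground_segment (fst b) (4 * R). hit_prob (level 0) y z))"
  have u: "(\<Sum>x\<in>B. hit_prob (B \<union> level 0) x z) \<le> g z" for z
  proof (rule sum_hit_prob_minimal)
    show "g z \<ge> 0" for z by (simp add: g_def sum_nonneg hit_prob_nonneg)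
    show "nbr_avg g z \<le> g z" if "z \<notin> B \<union> level 0" for z
    proof -
      have "nbr_avg g z = 2 * nbr_avg (\<lambda>z. \<Sum>y\<in>ground_segment (fst b) (4 * R). hit_prob (level 0) y z) z"
        by (simp add: nbr_avg_def g_def)
      then show ?thesis using that by (simp add: sum_hit_prob_harmonic g_def)
    qed
    show "g x \<ge> 1" if "x \<in> B \<inter> (B \<union> level 0)" for x
    proof -
      have x: "x \<in> B" using that by simp
      have 1: "\<bar>fst x - fst b\<bar> \<le> R"
        using connected_diff_le_card[OF B(1,2) x b(1), of fst] b0 b by (simp add: R_def)
      have 2: "snd x \<le> R"
        using connected_diff_le_card[OF B(1,2) x b(1), of snd] b by (simp add: R_def)
      have 3: "snd x \<ge> 0" using B x by (auto simp: upper_half_plane_def)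
      have "real_of_int (fst x - fst b) ^ 2 \<le> real_of_int R ^ 2"
        using 1 R by (intro power2_le_iff_abs_le[THEN iffD2]) linarith+
      moreover have "real_of_int (4 * R - snd x) ^ 2 \<ge> real_of_int (3 * R) ^ 2"
        using 2 R by (intro power_mono) linarith+
      ultimately have "real_of_int (4 * R - snd x) ^ 2 - real_of_int (fst x - fst b) ^ 2 \<ge>
          real_of_int (4 * R) ^ 2 / 2"
        by (simp add: power_mult_distrib)
      then have "(real_of_int (4 * R - snd x) ^ 2 - real_of_int (fst x - fst b) ^ 2) / real_of_int (4 * R) ^ 2 \<ge> 1 / 2"
        using R by (simp add: field_simps)
      also have "(real_of_int (4 * R - snd x) ^ 2 - real_of_int (fst x - fst b) ^ 2) / real_of_int (4 * R) ^ 2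
         \<le> (\<Sum>y\<in>ground_segment (fst b) (4 * R). hit_prob (level 0) y (fst x, snd x))"
        by (rule ground_segment_hit_prob_ge) (use 1 2 3 R in auto)
      finally show ?thesis by (simp add: g_def)
    qed
  qed (rule B)
  have "(\<Sum>k\<in>F. \<Sum>x\<in>B. hit_prob (B \<union> level 0) x (k, n)) \<le> (\<Sum>k\<in>F. g (k, n))"
    by (intro sum_mono u)
  also have "\<dots> = 2 * (\<Sum>y\<in>ground_segment (fst b) (4 * R). \<Sum>k\<in>F. hit_prob (level 0) y (k, n))"
    unfolding g_def by (subst sum.swap) (simp add: sum_distrib_left)
  also have "\<dots> \<le> 2 * (\<Sum>y\<in>ground_segment (fst b) (4 * R). 1)"
    unfolding sum_ground_segment
    by (intro mult_left_mono sum_mono sum_row_hit_prob_ground_le_1 F) auto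
  \<comment> \<open>The segment has \<open>2 * (4 * R) + 1\<close> points; \<open>R \<ge> 1\<close>
    then gives the constant \<open>18 = 2 * (8 + 1)\<close>.\<close>
  also have "\<dots> = 2 * (8 * real_of_int R + 1)"
    unfolding sum_ground_segment using R by (simp add: of_nat_nat)
  also have "\<dots> \<le> 18 * real_of_int R" using R by simp
  finally show ?thesis by (simp add: R_def)
qed

subsection \<open>Row sums\<close>

definition row_sum :: "(point \<Rightarrow> real) \<Rightarrow> int \<Rightarrow> real" where
  "row_sum f n = (\<Sum>\<^sub>\<infinity>k. f (k, n))"

text \<open>Equal increments make the sequence affine, and a nonzero slope would carry it beyond any
  bound.\<close>

lemma affine_bounded_constant:
  fixes a :: "nat \<Rightarrow> real"
  assumes step: "\<And>j. a (Suc (Suc j)) - a (Suc j) = a (Suc j) - a j"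
    and bd: "\<And>j. \<bar>a j\<bar> \<le> K"
  shows "a j = a 0"
proof -
  define \<delta> where "\<delta> = a 1 - a 0"
  have diff: "a (Suc j) - a j = \<delta>" for j
    by (induction j) (auto simp: \<delta>_def step)
  have aff: "a j = a 0 + real j * \<delta>" for j
  proof (induction j)
    case (Suc j)
    then show ?case using diff[of j] by (simp add: algebra_simps)
  qed simp
  have "\<delta> = 0"
  proof (rule ccontr)
    assume "\<delta> \<noteq> 0"
    then obtain j where "real j * \<bar>\<delta>\<bar> > 2 * K"
      using reals_Archimedean3[of "\<bar>\<delta>\<bar>"] by auto
    moreover have "real j * \<bar>\<delta>\<bar> = \<bar>a j - a 0\<bar>" using aff[of j] by (simp add: abs_mult)
    ultimately show False using bd[of j] bd[of 0] by linarith
  qed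
  then show ?thesis using aff by simp
qed

text \<open>Sum the harmonicity along a row: the two horizontal neighbours reproduce the same row
  sum after a shift of the index, so the second difference of the row sums in the height
  vanishes.\<close>

lemma row_sum_const:
  assumes bd: "\<And>F n. finite F \<Longrightarrow> (\<Sum>k\<in>F. f (k, n)) \<le> K" and nonneg: "\<And>z. f z \<ge> 0"
    and harm: "\<And>z. snd z > m \<Longrightarrow> nbr_avg f z = f z" and n: "n > m"
  shows "row_sum f n = row_sum f (m + 1)"
proof -
  have summ: "(\<lambda>k. f (k, n)) summable_on UNIV" for n
    by (rule nonneg_bdd_above_summable_on) (auto intro!: nonneg bdd_aboveI2 bd)
  have sh: "row_sum f n = (\<Sum>\<^sub>\<infinity>k. f (k + c, n))"
    and sm: "(\<lambda>k. f (k + c, n)) summable_on UNIV" for c n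
  proof -
    have "bij_betw (\<lambda>k. k + c) UNIV UNIV"
      by (rule bij_betw_byWitness[where f' = "\<lambda>k. k - c"]) auto
    from infsum_reindex_bij_betw[OF this, of "\<lambda>k. f (k, n)"]
      summable_on_reindex_bij_betw[OF this, of "\<lambda>k. f (k, n)"]
    show "row_sum f n = (\<Sum>\<^sub>\<infinity>k. f (k + c, n))" "(\<lambda>k. f (k + c, n)) summable_on UNIV"
      by (auto simp: row_sum_def summ)
  qed
  have rec: "4 * row_sum f n = 2 * row_sum f n + row_sum f (n + 1) + row_sum f (n - 1)"
    if "n > m" for n
  proof -
    have "4 * row_sum f n = (\<Sum>\<^sub>\<infinity>k. 4 * f (k, n))"
      by (simp add: row_sum_def infsum_cmult_right')
    also have "\<dots> = (\<Sum>\<^sub>\<infinity>k. (f (k + 1, n) + f (k + -1, n)) + (f (k, n + 1) + f (k, n - 1)))"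
    proof (rule infsum_cong)
      fix k
      show "4 * f (k, n) = (f (k + 1, n) + f (k + -1, n)) + (f (k, n + 1) + f (k, n - 1))"
        using harm[of "(k, n)"] that by (simp add: nbr_avg_def)
    qed
    also have "\<dots> = (row_sum f n + row_sum f n) + (row_sum f (n + 1) + row_sum f (n - 1))"
      by (subst infsum_add, (intro summable_on_add sm summ)+)+
        (simp only: sh[of n 1, symmetric] sh[of n "-1", symmetric] row_sum_def[symmetric])
    finally show ?thesis by simp
  qed
  have "row_sum f (m + 1 + int j) = row_sum f (m + 1 + int 0)" for j
  proof (rule affine_bounded_constant[where a = "\<lambda>j. row_sum f (m + 1 + int j)"])
    show "row_sum f (m + 1 + int (Suc (Suc j))) - row_sum f (m + 1 + int (Suc j)) =
        row_sum f (m + 1 + int (Suc j)) - row_sum f (m + 1 + int j)" for j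
      using rec[of "m + 1 + int (Suc j)"] by (simp add: algebra_simps)
    show "\<bar>row_sum f (m + 1 + int j)\<bar> \<le> K" for j
      unfolding row_sum_def
      by (subst abs_of_nonneg) (auto intro!: infsum_nonneg nonneg infsum_le_finite_sums summ bd)
  qed
  from this[of "nat (n - m - 1)"] show ?thesis using n by simp
qed

section \<open>The stationary harmonic measure as a row sum\<close>

lemma ennreal_infsum:
  fixes f :: "'a \<Rightarrow> real"
  assumes "f summable_on A" "\<And>x. x \<in> A \<Longrightarrow> f x \<ge> 0"
  shows "ennreal (infsum f A) = (\<Sum>\<^sub>\<infinity>x\<in>A. ennreal (f x))"
proof -
  have "(\<Sum>\<^sub>\<infinity>x\<in>A. ennreal (f x)) = (SUP F\<in>{F. finite F \<and> F \<subseteq> A}. \<Sum>x\<in>F. ennreal (f x))"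
    by (rule nonneg_infsum_complete) simp
  also have "\<dots> = (SUP F\<in>{F. finite F \<and> F \<subseteq> A}. ennreal (sum f F))"
    using assms(2) by (intro SUP_cong refl sum_ennreal) blast
  finally show ?thesis using infsum_nonneg_is_SUPREMUM_ennreal[OF assms] by simp
qed

lemma has_sum_finite_sum:
  fixes f :: "'b \<Rightarrow> 'a \<Rightarrow> 'c :: topological_comm_monoid_add"
  assumes "\<And>x. x \<in> X \<Longrightarrow> (f x has_sum s x) A"
  shows "((\<lambda>k. \<Sum>x\<in>X. f x k) has_sum (\<Sum>x\<in>X. s x)) A"
  using assms by (induction X rule: infinite_finite_induct) (auto intro: has_sum_add)

lemma harm_from_level_eq:
  assumes "\<And>z. z \<in> B \<Longrightarrow> snd z < int N"
    "(\<lambda>k. hit_prob (B \<union> level 0) x (k, int N)) summable_on UNIV"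
  shows "harm_from_level B N x = ennreal (row_sum (hit_prob (B \<union> level 0) x) (int N))"
proof -
  have em: "emeasure (srw z) {S \<in> space (srw z). hits_at A x S} = ennreal (hit_prob A x z)" for A z
    unfolding hit_prob_def
    by (rule finite_measure.emeasure_eq_measure) (simp add: prob_space_srw prob_space.finite_measure)
  have "level N - B = level N" using assms(1) by (force simp: level_def)
  then have "harm_from_level B N x = (\<Sum>\<^sub>\<infinity>z\<in>level N. ennreal (hit_prob (B \<union> level 0) x z))"
    by (simp add: harm_from_level_def em)
  also have "\<dots> = (\<Sum>\<^sub>\<infinity>k. ennreal (hit_prob (B \<union> level 0) x (k, int N)))"
    by (rule infsum_reindex_bij_witness[of _ "\<lambda>k. (k, int N)" fst]) (auto simp: level_def)
  also have "\<dots> = ennreal (row_sum (hit_prob (B \<union> level 0) x) (int N))"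
    unfolding row_sum_def by (subst ennreal_infsum) (auto simp: assms hit_prob_nonneg)
  finally show ?thesis .
qed

lemma hit_prob_row_summable:
  assumes B: "finite B" "lattice_connected B" "B \<subseteq> upper_half_plane" "x \<in> B"
  shows "finite F \<Longrightarrow> (\<Sum>k\<in>F. hit_prob (B \<union> level 0) x (k, n)) \<le>
      18 * (real_of_int (Min (snd ` B)) + real (card B))" (is "_ \<Longrightarrow> _ \<le> ?K")
    and "(\<lambda>k. hit_prob (B \<union> level 0) x (k, n)) summable_on UNIV"
proof -
  show bd: "(\<Sum>k\<in>F. hit_prob (B \<union> level 0) x (k, n)) \<le> ?K" if "finite F" for F n
  proof -
    have "(\<Sum>k\<in>F. hit_prob (B \<union> level 0) x (k, n)) \<le>
        (\<Sum>k\<in>F. \<Sum>x\<in>B. hit_prob (B \<union> level 0) x (k, n))"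
      using B by (intro sum_mono member_le_sum) (auto simp: hit_prob_nonneg)
    also have "\<dots> \<le> ?K" using B that by (intro sum_row_hit_prob_le) auto
    finally show ?thesis .
  qed
  show "(\<lambda>k. hit_prob (B \<union> level 0) x (k, n)) summable_on UNIV"
    by (rule nonneg_bdd_above_summable_on) (auto intro!: hit_prob_nonneg bdd_aboveI2 bd)
qed

lemma stationary_harm_eq:
  assumes B: "finite B" "lattice_connected B" "B \<subseteq> upper_half_plane" "x \<in> B"
  shows "stationary_harm B x =
    ennreal (row_sum (hit_prob (B \<union> level 0) x) (Max (snd ` B) + 1))" (is "_ = ennreal ?r")
proof -
  let ?M = "Max (snd ` B)"
  have le: "snd z \<le> ?M" if "z \<in> B" for z using that B by simp
  have M: "?M \<ge> 0" using le[OF B(4)] subsetD[OF B(3,4)] by (simp add: upper_half_plane_def)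
  have "harm_from_level B N x = ennreal ?r" if N: "int N > ?M" for N
  proof -
    have "harm_from_level B N x = ennreal (row_sum (hit_prob (B \<union> level 0) x) (int N))"
      using le N hit_prob_row_summable(2)[OF B] by (intro harm_from_level_eq) (auto intro: le_less_trans)
    also have "row_sum (hit_prob (B \<union> level 0) x) (int N) = ?r"
    proof (rule row_sum_const[OF hit_prob_row_summable(1)[OF B] hit_prob_nonneg _ N])
      fix z :: point assume "snd z > ?M"
      then have "z \<notin> B \<union> level 0" using le[of z] M by (auto simp: level_def)
      then show "nbr_avg (hit_prob (B \<union> level 0) x) z = hit_prob (B \<union> level 0) x z"
        by (rule hit_prob_harmonic)
    qed
    finally show ?thesis .
  qed
  then have "eventually (\<lambda>N. harm_from_level B N x = ennreal ?r) sequentially"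
    by (intro eventually_sequentiallyI[of "nat (?M + 1)"]) auto
  then have "(\<lambda>N. harm_from_level B N x) \<longlonglongrightarrow> ennreal ?r"
    by (rule tendsto_eventually)
  then show ?thesis unfolding stationary_harm_def by (rule limI)
qed

lemma sum_hit_prob_row_summable:
  assumes B: "finite B" "lattice_connected B" "B \<subseteq> upper_half_plane"
  shows "(\<lambda>k. \<Sum>x\<in>B. hit_prob (B \<union> level 0) x (k, n)) summable_on UNIV"
  by (rule has_sum_imp_summable, rule has_sum_finite_sum)
    (rule has_sum_infsum, rule hit_prob_row_summable(2)[OF B])

lemma total_stationary_harm_eq:
  assumes B: "finite B" "lattice_connected B" "B \<subseteq> upper_half_plane"
  shows "total_stationary_harm B =
    ennreal (row_sum (\<lambda>z. \<Sum>x\<in>B. hit_prob (B \<union> level 0) x z) (Max (snd ` B) + 1))"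
proof -
  have "total_stationary_harm B =
      (\<Sum>x\<in>B. ennreal (row_sum (hit_prob (B \<union> level 0) x) (Max (snd ` B) + 1)))"
    unfolding total_stationary_harm_def by (intro sum.cong refl stationary_harm_eq B)
  also have "\<dots> = ennreal (\<Sum>x\<in>B. row_sum (hit_prob (B \<union> level 0) x) (Max (snd ` B) + 1))"
    by (intro sum_ennreal) (simp add: row_sum_def infsum_nonneg hit_prob_nonneg)
  also have "(\<Sum>x\<in>B. row_sum (hit_prob (B \<union> level 0) x) (Max (snd ` B) + 1)) =
      row_sum (\<lambda>z. \<Sum>x\<in>B. hit_prob (B \<union> level 0) x z) (Max (snd ` B) + 1)"
    unfolding row_sum_def
    by (intro infsumI[symmetric] has_sum_finite_sum has_sum_infsum hit_prob_row_summable(2)[OF B])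
  finally show ?thesis .
qed

text \<open>By nonnegativity any finite piece of the row just above \<open>B\<close> bounds the full
  row sum from below; both lower bounds use this.\<close>

lemma total_stationary_harm_ge:
  assumes B: "finite B" "lattice_connected B" "B \<subseteq> upper_half_plane" and F: "finite F"
    and le: "r \<le> (\<Sum>k\<in>F. \<Sum>x\<in>B. hit_prob (B \<union> level 0) x (k, Max (snd ` B) + 1))"
  shows "ennreal r \<le> total_stationary_harm B"
  unfolding total_stationary_harm_eq[OF B] row_sum_def
  by (intro ennreal_leI order_trans[OF le] finite_sum_le_infsum F
      sum_hit_prob_row_summable[OF B])
    (auto intro!: sum_nonneg hit_prob_nonneg)

lemma total_stationary_harm_le:
  assumes B: "finite B" "lattice_connected B" "B \<subseteq> upper_half_plane" "B \<noteq> {}"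
  shows "total_stationary_harm B \<le> ennreal (18 * (real_of_int (Min (snd ` B)) + real (card B)))"
  unfolding total_stationary_harm_eq[OF B(1-3)] row_sum_def
  by (intro ennreal_leI infsum_le_finite_sums sum_hit_prob_row_summable[OF B(1-3)]
      sum_row_hit_prob_le B)

text \<open>Here \<open>B \<union> level 0\<close> is \<open>level 0\<close>, and a single point of
  \<open>B\<close> already receives mass arbitrarily close to \<open>1\<close> from row
  \<open>1\<close>.\<close>

lemma total_stationary_harm_ground_ge_1:
  assumes B: "finite B" "lattice_connected B" "B \<subseteq> upper_half_plane" "B \<noteq> {}"
    and M: "Max (snd ` B) = 0"
  shows "total_stationary_harm B \<ge> 1"
proof -
  have snd0: "snd x = 0" if "x \<in> B" for x
  proof -
    have "snd x \<le> Max (snd ` B)" using that B by simp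
    then show ?thesis using M B that by (force simp: upper_half_plane_def)
  qed
  then have A: "B \<union> level 0 = level 0" by (auto simp: level_def)
  obtain j where j: "(j, 0) \<in> B" using snd0 B(4) by (metis ex_in_conv prod.collapse)
  have "ennreal ((real (Suc T) / real (Suc (Suc T))) ^ 2) \<le> total_stationary_harm B" for T
  proof (rule total_stationary_harm_ge[OF B(1-3)])
    \<comment> \<open>Chosen so that \<open>(?T - 1) / ?T\<close> is the shifted form of
      \<open>n / Suc n\<close>, whose limit is \<open>1\<close>.\<close>
    let ?T = "int T + 2"
    have "(real_of_int (?T - 1) / real_of_int ?T) ^ 2 \<le>
        (\<Sum>k\<in>{j - ?T..j + ?T}. hit_prob (level 0) (j, 0) (k, 1))"
      by (rule sum_row_hit_prob_ground_ge) auto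
    also have "\<dots> \<le> (\<Sum>k\<in>{j - ?T..j + ?T}. \<Sum>x\<in>B. hit_prob (B \<union> level 0) x (k, Max (snd ` B) + 1))"
      unfolding A M using B j
      by (intro sum_mono) (auto intro!: member_le_sum simp: hit_prob_nonneg)
    finally show "(real (Suc T) / real (Suc (Suc T))) ^ 2 \<le> \<dots>" by (simp add: add_ac)
  qed simp
  moreover have "(\<lambda>T. ennreal ((real (Suc T) / real (Suc (Suc T))) ^ 2)) \<longlonglongrightarrow> ennreal (1 ^ 2)"
    by (intro tendsto_ennrealI tendsto_power LIMSEQ_Suc[OF LIMSEQ_n_over_Suc_n])
  ultimately show ?thesis
    by (intro LIMSEQ_le_const2[where X = "\<lambda>T. ennreal ((real (Suc T) / real (Suc (Suc T))) ^ 2)"]) auto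
qed

subsection \<open>The logarithmic kernel\<close>

text \<open>The shift \<open>1/2\<close> is the one for which the product identity below holds; the value at the origin only has to
  exceed \<open>ln (7/2) + 2 ln (3/2) + 4 ln 2\<close>, which is what subharmonicity at the unit steps asks for.\<close>

definition log_kernel :: "point \<Rightarrow> real" where
  "log_kernel z = (if z = 0 then 8
     else - ln (real_of_int (fst z) ^ 2 + real_of_int (snd z) ^ 2 - 1 / 2))"

text \<open>Integrality of the coordinates. It keeps the argument of the logarithm in
  \<open>log_kernel\<close> at least \<open>1 / 2\<close> off the origin.\<close>

lemma sq_sum_ge_1:
  assumes "z \<noteq> (0 :: point)"
  shows "real_of_int (fst z) ^ 2 + real_of_int (snd z) ^ 2 \<ge> 1"
proof -
  have "fst z ^ 2 + snd z ^ 2 > 0"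
    using assms by (cases z) (simp add: sum_power2_gt_zero_iff zero_prod_def)
  then have "fst z ^ 2 + snd z ^ 2 \<ge> 1" by simp
  then have "real_of_int (fst z ^ 2 + snd z ^ 2) \<ge> 1" by linarith
  then show ?thesis by simp
qed

text \<open>Off the origin the kernel is at most \<open>- ln (1 / 2) = ln 2\<close>, well below its
  value at the origin.\<close>

lemma log_kernel_le_8: "log_kernel z \<le> 8"
proof (cases "z = 0")
  case False
  have "ln (1 / 2 :: real) \<le> ln (real_of_int (fst z) ^ 2 + real_of_int (snd z) ^ 2 - 1 / 2)"
    using sq_sum_ge_1[OF False] by (subst ln_le_cancel_iff) auto
  moreover have "ln (1 / 2 :: real) \<ge> -1" using ln_2_less_1 by (simp add: ln_div)
  ultimately show ?thesis using False by (simp add: log_kernel_def)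
qed (simp add: log_kernel_def)

text \<open>With \<open>s = a\<^sup>2 + b\<^sup>2 - 1/2\<close> the product of the values of \<open>s\<close> at the four neighbours of \<open>(a, b)\<close>
  equals \<open>s\<^sup>4 - 4 (a\<^sup>2 - b\<^sup>2)\<^sup>2\<close>.\<close>

lemma log_kernel_subharmonic:
  assumes "z \<noteq> 0"
  shows "log_kernel z \<le> nbr_avg log_kernel z"
proof (cases "z \<in> unit_steps")
  case True
  \<comment> \<open>A unit step has as neighbours the origin, a point at distance 2 and two diagonal
    points; the shifted squares are \<open>7 / 2\<close> and \<open>3 / 2\<close> at the latter, and
    \<open>1 / 2\<close> at the step itself. The bounds used give
    \<open>5 / 2 + 1 + 4 < 8\<close>.\<close>
  have "ln (7 / 2 :: real) + 2 * ln (3 / 2) - 4 * ln (1 / 2) \<le> 8"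
    using ln_le_minus_one[of "7 / 2 :: real"] ln_le_minus_one[of "3 / 2 :: real"] ln_2_less_1
    by (simp add: ln_div)
  then show ?thesis
    using True by (auto simp: unit_steps_def nbr_avg_def log_kernel_def zero_prod_def)
next
  case False
  define q where "q = (\<lambda>w :: point. real_of_int (fst w) ^ 2 + real_of_int (snd w) ^ 2 - 1 / 2)"
  have ne: "z + e \<noteq> 0" if "e \<in> unit_steps" for e
  proof
    assume "z + e = 0"
    then have "z = - e" by (simp add: eq_neg_iff_add_eq_0)
    then show False using that False by (auto simp: unit_steps_def)
  qed
  have lk: "log_kernel w = - ln (q w)" "q w > 0" if "w \<noteq> 0" for w
    using that sq_sum_ge_1[OF that] by (auto simp: log_kernel_def q_def)
  note n = ne[of "(1, 0)"] ne[of "(-1, 0)"] ne[of "(0, 1)"] ne[of "(0, -1)"]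
  note n = n[unfolded unit_steps_def, simplified]
  have "ln (q (z + (1, 0))) + ln (q (z + (-1, 0))) + ln (q (z + (0, 1))) + ln (q (z + (0, -1))) =
      ln (q (z + (1, 0)) * q (z + (-1, 0)) * q (z + (0, 1)) * q (z + (0, -1)))"
    using n[THEN lk(2)] by (simp add: ln_mult)
  also have "\<dots> \<le> ln (q z ^ 4)"
  proof (rule ln_mono)
    have "q z ^ 4 - q (z + (1, 0)) * q (z + (-1, 0)) * q (z + (0, 1)) * q (z + (0, -1)) =
        4 * (real_of_int (fst z) ^ 2 - real_of_int (snd z) ^ 2) ^ 2"
      unfolding q_def by simp algebra
    then show "q (z + (1, 0)) * q (z + (-1, 0)) * q (z + (0, 1)) * q (z + (0, -1)) \<le> q z ^ 4"
      using zero_le_power2[of "real_of_int (fst z) ^ 2 - real_of_int (snd z) ^ 2"] by linarith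
  qed (use n[THEN lk(2)] in simp)
  also have "\<dots> = 4 * ln (q z)" using lk(2)[OF assms] by (simp add: ln_realpow)
  finally show ?thesis
    unfolding nbr_avg_def lk(1)[OF assms] n[THEN lk(1)] by simp
qed

section \<open>The logarithmic lower bound\<close>

lemma nbr_avg_affine_shift:
  "nbr_avg (\<lambda>z. f (z - b) + c - g z * e) z = nbr_avg f (z - b) + c - nbr_avg g z * e"
  by (simp add: nbr_avg_def diff_add_eq field_simps)

text \<open>Maximum principle for the difference of the two sides. On \<open>B\<close> the hitting
  sum is \<open>1\<close> and the kernel at most \<open>8\<close>, whence the factor; at distance
  \<open>snd b\<close> or more from \<open>b\<close> the right-hand side is nonpositive off
  \<open>B\<close>.\<close>

lemma sum_hit_prob_ge_log_kernel:
  assumes B: "finite B" "b \<in> B" and M: "snd b \<ge> 2"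
  shows "(\<Sum>x\<in>B. hit_prob (B \<union> level 0) x z) * (8 + ln (real_of_int (snd b) ^ 2 - 1 / 2)) \<ge>
    log_kernel (z - b) + ln (real_of_int (snd b) ^ 2 - 1 / 2)"
proof -
  let ?u = "\<lambda>z. \<Sum>x\<in>B. hit_prob (B \<union> level 0) x z"
  let ?l = "ln (real_of_int (snd b) ^ 2 - 1 / 2)"
  let ?M = "snd b"
  define d where "d = (\<lambda>z. log_kernel (z - b) + ?l - ?u z * (8 + ?l))"
  \<comment> \<open>The ball is open and its radius is the height of its centre, so it misses
    \<open>level 0\<close> and the hitting sum is harmonic on all of \<open>D\<close>.\<close>
  define D where "D = {z. fst (z - b) ^ 2 + snd (z - b) ^ 2 < ?M ^ 2} - B"
  have M2: "real_of_int ?M ^ 2 \<ge> 2 ^ 2" using M by (intro power_mono) auto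
  have l: "?l \<ge> 0" using M2 by (intro ln_ge_zero) auto
  have "d z \<le> 0"
  proof (rule nbr_avg_max_principle)
    have "z \<in> {fst b - ?M..fst b + ?M} \<times> {0..2 * ?M}"
      if z: "fst (z - b) ^ 2 + snd (z - b) ^ 2 < ?M ^ 2" for z
    proof -
      have "fst (z - b) ^ 2 < ?M ^ 2" "snd (z - b) ^ 2 < ?M ^ 2"
        using z zero_le_power2[of "fst (z - b)"] zero_le_power2[of "snd (z - b)"] by linarith+
      then have "\<bar>fst (z - b)\<bar> \<le> \<bar>?M\<bar>" "\<bar>snd (z - b)\<bar> \<le> \<bar>?M\<bar>"
        unfolding abs_le_square_iff by simp_all
      then show ?thesis using M by (cases z) auto
    qed
    then have "D \<subseteq> {fst b - ?M..fst b + ?M} \<times> {0..2 * ?M}" unfolding D_def by blast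
    then show "finite D" by (rule finite_subset) simp
  next
    fix z assume z: "z \<in> D"
    then have "z \<notin> B \<union> level 0" by (auto simp: D_def level_def)
    then have u: "nbr_avg ?u z = ?u z" by (rule sum_hit_prob_harmonic)
    have "z - b \<noteq> 0" using z B by (auto simp: D_def)
    then have "log_kernel (z - b) \<le> nbr_avg log_kernel (z - b)" by (rule log_kernel_subharmonic)
    moreover have "nbr_avg d z = nbr_avg log_kernel (z - b) + ?l - nbr_avg ?u z * (8 + ?l)"
      unfolding d_def by (rule nbr_avg_affine_shift)
    ultimately show "d z \<le> nbr_avg d z" by (simp add: d_def u)
  next
    fix z assume z: "z \<notin> D"
    show "d z \<le> 0"
    proof (cases "z \<in> B")
      case True
      then have "?u z = 1" using B by (simp add: sum_hit_prob_hit)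
      then show ?thesis using log_kernel_le_8[of "z - b"] by (simp add: d_def)
    next
      case False
      then have r: "fst (z - b) ^ 2 + snd (z - b) ^ 2 \<ge> ?M ^ 2" using z by (auto simp: D_def)
      then have r': "real_of_int (fst (z - b)) ^ 2 + real_of_int (snd (z - b)) ^ 2 \<ge> real_of_int ?M ^ 2"
        by (metis of_int_add of_int_le_iff of_int_power)
      have "z - b \<noteq> 0" using False B by auto
      then have "log_kernel (z - b) + ?l \<le> 0"
        using r' M2 by (simp add: log_kernel_def)
      moreover have "?u z * (8 + ?l) \<ge> 0"
        using l by (intro mult_nonneg_nonneg sum_nonneg hit_prob_nonneg) auto
      ultimately show ?thesis by (simp add: d_def)
    qed
  qed
  then show ?thesis by (simp add: d_def)
qed

lemma total_stationary_harm_ge_log: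
  assumes B: "finite B" "lattice_connected B" "B \<subseteq> upper_half_plane" "B \<noteq> {}"
    and M: "Max (snd ` B) \<ge> 2"
  shows "total_stationary_harm B \<ge>
    ennreal (1 / 36 * (real_of_int (Max (snd ` B)) / ln (real_of_int (Max (snd ` B)))))"
proof -
  let ?M = "Max (snd ` B)"
  let ?u = "\<lambda>z. \<Sum>x\<in>B. hit_prob (B \<union> level 0) x z"
  have "?M \<in> snd ` B" using B by (intro Max_in) auto
  then obtain b where b: "b \<in> B" "snd b = ?M" by auto
  define l where "l = ln (real_of_int ?M ^ 2 - 1 / 2)"
  \<comment> \<open>The \<open>2 * h + 1 \<ge> ?M\<close> points of row \<open>?M + 1\<close> within
    horizontal distance \<open>h\<close> of \<open>b\<close> supply the factor
    \<open>?M\<close>.\<close>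
  define h where "h = ?M div 2"
  have M2: "real_of_int ?M ^ 2 \<ge> 2 ^ 2" using M by (intro power_mono) auto
  have l: "l \<ge> 0" unfolding l_def using M2 by (intro ln_ge_zero) auto
  have ln2: "ln (2 :: real) \<ge> 1 / 2" using ln_le_minus_one[of "1 / 2 :: real"] by (simp add: ln_div)
  have lnM: "ln (real_of_int ?M) \<ge> ln 2" using M by (subst ln_le_cancel_iff) auto
  have "l \<le> ln (real_of_int ?M ^ 2)" unfolding l_def using M2 by (subst ln_le_cancel_iff) auto
  also have "\<dots> = 2 * ln (real_of_int ?M)" using M by (simp add: ln_realpow)
  \<comment> \<open>Since \<open>ln ?M \<ge> 1 / 2\<close>, the constant \<open>8\<close> is at most
    \<open>16 * ln ?M\<close>.\<close>
  finally have G: "8 + l \<le> 18 * ln (real_of_int ?M)" using lnM ln2 by linarith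
  have u: "?u (k, ?M + 1) \<ge> 1 / 36 / ln (real_of_int ?M)" if k: "k \<in> {fst b - h..fst b + h}" for k
  proof -
    have "2 * h \<le> ?M" by (simp add: h_def)
    moreover have "\<bar>k - fst b\<bar> \<le> h" using k by auto
    ultimately have "\<bar>real_of_int (k - fst b)\<bar> \<le> real_of_int ?M / 2" by linarith
    then have "real_of_int (k - fst b) ^ 2 \<le> (real_of_int ?M / 2) ^ 2"
      by (metis abs_ge_zero power2_abs power_mono)
    \<comment> \<open>The row lies one above \<open>b\<close>, so the shifted square is
      \<open>(k - fst b)^2 + 1 - 1 / 2\<close>. Fitting twice this below \<open>?M^2 - 1 / 2\<close>
      leaves a gain of \<open>ln 2 \<ge> 1 / 2\<close>; division by \<open>18 * ln ?M\<close> yields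
      \<open>1 / 36\<close>.\<close>
    then have "2 * (real_of_int (k - fst b) ^ 2 + 1 / 2) \<le> real_of_int ?M ^ 2 - 1 / 2"
      using M2 by (simp add: power_divide)
    then have "ln (2 * (real_of_int (k - fst b) ^ 2 + 1 / 2)) \<le> l"
      unfolding l_def by (intro ln_mono) (auto intro: add_nonneg_pos)
    also have "ln (2 * (real_of_int (k - fst b) ^ 2 + 1 / 2)) = ln 2 - log_kernel ((k, ?M + 1) - b)"
    proof -
      have pos: "real_of_int (k - fst b) ^ 2 + 1 / 2 > 0" by (intro add_nonneg_pos) auto
      have "(k, ?M + 1) - b \<noteq> 0" using b by (auto simp: prod_eq_iff)
      then have "log_kernel ((k, ?M + 1) - b) = - ln (real_of_int (k - fst b) ^ 2 + 1 / 2)"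
        using b by (simp add: log_kernel_def add.commute)
      then show ?thesis using ln_mult_pos[of 2, OF _ pos] by simp
    qed
    finally have "1 / 2 \<le> log_kernel ((k, ?M + 1) - b) + l" using ln2 by linarith
    also have "\<dots> \<le> ?u (k, ?M + 1) * (8 + l)"
      using sum_hit_prob_ge_log_kernel[OF B(1) b(1), of "(k, ?M + 1)"] M by (simp add: b l_def)
    also have "\<dots> \<le> ?u (k, ?M + 1) * (18 * ln (real_of_int ?M))"
      using G by (intro mult_left_mono) (auto intro!: sum_nonneg hit_prob_nonneg)
    finally show ?thesis using lnM ln2 by (simp add: field_simps)
  qed
  show ?thesis
  proof (rule total_stationary_harm_ge[OF B(1-3)])
    have "?M \<le> 2 * h + 1" by (simp add: h_def)
    then have "1 / 36 * (real_of_int ?M / ln (real_of_int ?M)) \<le>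
        real_of_int (2 * h + 1) * (1 / 36 / ln (real_of_int ?M))"
      using lnM ln2 by (simp add: divide_right_mono)
    also have "real_of_int (2 * h + 1) = real (card {fst b - h..fst b + h})"
      using M by (simp add: h_def)
    also have "\<dots> * (1 / 36 / ln (real_of_int ?M)) \<le> (\<Sum>k\<in>{fst b - h..fst b + h}. ?u (k, ?M + 1))"
      by (intro sum_bounded_below u)
    finally show "1 / 36 * (real_of_int ?M / ln (real_of_int ?M)) \<le>
        (\<Sum>k\<in>{fst b - h..fst b + h}. ?u (k, ?M + 1))" .
  qed simp
qed

theorem theorem3:
  "\<exists>c C :: real. 0 < c \<and> 0 < C \<and>
     (\<forall>B :: point set. B \<noteq> {} \<and> finite B \<and> lattice_connected B \<and> B \<subseteq> upper_half_plane \<longrightarrow>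
        total_stationary_harm B \<le> ennreal (C * (real_of_int (Min (snd ` B)) + real (card B))) \<and>
        (Max (snd ` B) \<ge> 2 \<longrightarrow>
           total_stationary_harm B
             \<ge> ennreal (c * (real_of_int (Max (snd ` B)) / ln (real_of_int (Max (snd ` B)))))) \<and>
        (Max (snd ` B) = 0 \<longrightarrow> total_stationary_harm B \<ge> 1))"
proof (rule exI[of _ "1 / 36"], rule exI[of _ 18], intro conjI allI impI)
  fix B :: "point set"
  assume "B \<noteq> {} \<and> finite B \<and> lattice_connected B \<and> B \<subseteq> upper_half_plane"
  then have B: "finite B" "lattice_connected B" "B \<subseteq> upper_half_plane" "B \<noteq> {}" by blast+
  show "total_stationary_harm B \<le> ennreal (18 * (real_of_int (Min (snd ` B)) + real (card B)))"
    by (rule total_stationary_harm_le[OF B])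
  show "total_stationary_harm B
      \<ge> ennreal (1 / 36 * (real_of_int (Max (snd ` B)) / ln (real_of_int (Max (snd ` B)))))"
    if "Max (snd ` B) \<ge> 2"
    by (rule total_stationary_harm_ge_log[OF B that])
  show "total_stationary_harm B \<ge> 1" if "Max (snd ` B) = 0"
    by (rule total_stationary_harm_ground_ge_1[OF B that])
qed simp_all

end
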